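(* Let $\mathbb K$ be a field, $X$ a finite set and $G$ a permutation groupoid on $X$. Then the invariant ring $\mathbb K[X]^G$ is finitely generated both as an algebra and as a module over the ring $\operatorname{Sym}(X)$ of symmetric polynomials, by homogeneous elements of degree at most $\frac{|X|(|X|+1)}{2}$. Moreover this degree bound is tight: there exist finite sets $X$ and permutation groupoids $G$ on $X$ such that $\mathbb K[X]^G$ is not generated as a $\operatorname{Sym}(X)$-module by its elements of degree less than $\frac{|X|(|X|+1)}{2}$.
   Context: A local bijection of $X$ is a bijection $f:\operatorname{dom}f\to\operatorname{im}f$ between subsets of $X$. A permutation groupoid on $X$ is a set $G$ of local bijections containing the identity of $X$ and closed under restriction to subsets of the domain, inverses, and composition $f\circ g$ whenever $\operatorname{im}g=\operatorname{dom}f$. For $f\in G$ and a monomial $x^d=\prod_{i\in X}x_i^{d_i}$ whose support is contained in $\operatorname{dom}f$, set $f.x^d=\prod_{d_i>0}x_{f(i)}^{d_i}$. The $G$-orbit of $x^d$ is the set of all such $f.x^d$ ($f\in G$), its orbit sum is the sum of the monomials in the orbit, and the invariant ring $\mathbb K[X]^G$ is the linear span of all orbit sums in $\mathbb K[X]$; it is a graded subring of $\mathbb K[X]$ containing $\operatorname{Sym}(X)$. *)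

theory Defs
  imports Complex_Main "HOL-Library.Poly_Mapping" "HOL-Combinatorics.Permutations"
begin

section \<open>Local bijections and permutation groupoids\<close>

text \<open>A map \<open>f :: 'x \<rightharpoonup> 'x\<close> is the bijection from \<open>dom f\<close> onto \<open>ran f\<close> when it is injective
  on its domain.\<close>

definition local_bijection :: "'x set \<Rightarrow> ('x \<rightharpoonup> 'x) \<Rightarrow> bool" where
  "local_bijection X f \<longleftrightarrow> dom f \<subseteq> X \<and> ran f \<subseteq> X \<and> inj_on f (dom f)"

definition map_inverse :: "('x \<rightharpoonup> 'x) \<Rightarrow> ('x \<rightharpoonup> 'x)" where
  "map_inverse f = (\<lambda>y. if y \<in> ran f then Some (THE x. f x = Some y) else None)"

lemma map_inverse_eq_Some_iff:
  assumes "inj_on f (dom f)"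
  shows "map_inverse f y = Some x \<longleftrightarrow> f x = Some y"
proof -
  have uniq: "(THE x. f x = Some y) = x" if "f x = Some y" for x
    using that assms by (intro the_equality) (auto simp: inj_on_def dom_def)
  show ?thesis
    using uniq by (auto simp: map_inverse_def ran_def)
qed

definition permutation_groupoid :: "'x set \<Rightarrow> ('x \<rightharpoonup> 'x) set \<Rightarrow> bool" where
  "permutation_groupoid X G \<longleftrightarrow>
     (\<forall>f\<in>G. local_bijection X f) \<and>
     Some |` X \<in> G \<and>
     (\<forall>f\<in>G. \<forall>A. A \<subseteq> dom f \<longrightarrow> f |` A \<in> G) \<and>
     (\<forall>f\<in>G. map_inverse f \<in> G) \<and>
     (\<forall>f\<in>G. \<forall>g\<in>G. ran g = dom f \<longrightarrow> f \<circ>\<^sub>m g \<in> G)"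


section \<open>Polynomials\<close>

text \<open>Exponent vectors of monomials are finitely supported functions \<open>'x \<Rightarrow>\<^sub>0 nat\<close>, and
  polynomials are finitely supported functions from exponent vectors to coefficients. Their
  ring multiplication in the library is convolution, that is, polynomial multiplication;
  the monomial with exponent vector \<open>d\<close> is \<open>Poly_Mapping.single d 1\<close> and the constant
  \<open>c\<close> is \<open>Poly_Mapping.single 0 c\<close>. The polynomials in the variables \<open>X\<close> form a
  subset of this type.\<close>

type_synonym ('x, 'k) mpoly = "('x \<Rightarrow>\<^sub>0 nat) \<Rightarrow>\<^sub>0 'k"

definition polys_in :: "'x set \<Rightarrow> ('x, 'k::zero) mpoly set" where
  "polys_in X = {p. \<forall>d \<in> Poly_Mapping.keys p. Poly_Mapping.keys d \<subseteq> X}"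

definition monom_degree :: "('x \<Rightarrow>\<^sub>0 nat) \<Rightarrow> nat" where
  "monom_degree d = (\<Sum>i\<in>Poly_Mapping.keys d. Poly_Mapping.lookup d i)"

definition homogeneous :: "nat \<Rightarrow> ('x, 'k::zero) mpoly \<Rightarrow> bool" where
  "homogeneous n p \<longleftrightarrow> (\<forall>d \<in> Poly_Mapping.keys p. monom_degree d = n)"

text \<open>The zero polynomial satisfies \<open>degree_less n\<close> for every \<open>n\<close>.\<close>

definition degree_less :: "nat \<Rightarrow> ('x, 'k::zero) mpoly \<Rightarrow> bool" where
  "degree_less n p \<longleftrightarrow> (\<forall>d \<in> Poly_Mapping.keys p. monom_degree d < n)"

definition rename_monom :: "('x \<Rightarrow> 'x) \<Rightarrow> ('x \<Rightarrow>\<^sub>0 nat) \<Rightarrow> ('x \<Rightarrow>\<^sub>0 nat)" where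
  "rename_monom s d = (\<Sum>i\<in>Poly_Mapping.keys d. Poly_Mapping.single (s i) (Poly_Mapping.lookup d i))"

definition rename_poly :: "('x \<Rightarrow> 'x) \<Rightarrow> ('x, 'k::comm_monoid_add) mpoly \<Rightarrow> ('x, 'k) mpoly" where
  "rename_poly s p =
     (\<Sum>d\<in>Poly_Mapping.keys p. Poly_Mapping.single (rename_monom s d) (Poly_Mapping.lookup p d))"

definition symmetric_polys :: "'x set \<Rightarrow> ('x, 'k::comm_monoid_add) mpoly set" where
  "symmetric_polys X = {p \<in> polys_in X. \<forall>s. s permutes X \<longrightarrow> rename_poly s p = p}"


section \<open>The invariant ring\<close>

text \<open>\<open>monom_orbit G d\<close> is the set of the exponent vectors of the monomials in the orbit. It is
  finite for every permutation groupoid \<open>G\<close> on a finite set.\<close>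

definition monom_orbit :: "('x \<rightharpoonup> 'x) set \<Rightarrow> ('x \<Rightarrow>\<^sub>0 nat) \<Rightarrow> ('x \<Rightarrow>\<^sub>0 nat) set" where
  "monom_orbit G d = {rename_monom (the \<circ> f) d | f. f \<in> G \<and> Poly_Mapping.keys d \<subseteq> dom f}"

definition orbit_sum :: "('x \<rightharpoonup> 'x) set \<Rightarrow> ('x \<Rightarrow>\<^sub>0 nat) \<Rightarrow> ('x, 'k::comm_semiring_1) mpoly" where
  "orbit_sum G d = (\<Sum>e\<in>monom_orbit G d. Poly_Mapping.single e 1)"

interpretation mpoly: vector_space "\<lambda>(c::'k::field) (p::('x, 'k) mpoly). Poly_Mapping.single 0 c * p"
  by unfold_locales
    (simp_all add: algebra_simps single_add mult_single flip: mult.assoc)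

definition invariant_ring :: "'x set \<Rightarrow> ('x \<rightharpoonup> 'x) set \<Rightarrow> ('x, 'k::field) mpoly set" where
  "invariant_ring X G = mpoly.span {orbit_sum G d | d. Poly_Mapping.keys d \<subseteq> X}"


section \<open>Generated algebras and modules\<close>

definition is_subalgebra :: "('x, 'k::field) mpoly set \<Rightarrow> bool" where
  "is_subalgebra A \<longleftrightarrow>
     (\<forall>c. Poly_Mapping.single 0 c \<in> A) \<and>
     (\<forall>p\<in>A. \<forall>q\<in>A. p + q \<in> A \<and> p * q \<in> A)"

definition is_submodule :: "'a::comm_ring_1 set \<Rightarrow> 'a set \<Rightarrow> bool" where
  "is_submodule R M \<longleftrightarrow>
     0 \<in> M \<and> (\<forall>p\<in>M. \<forall>q\<in>M. p + q \<in> M) \<and> (\<forall>r\<in>R. \<forall>p\<in>M. r * p \<in> M)"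

definition algebra_generated :: "('x, 'k::field) mpoly set \<Rightarrow> ('x, 'k) mpoly set" where
  "algebra_generated S = is_subalgebra hull S"

definition module_generated :: "'a::comm_ring_1 set \<Rightarrow> 'a set \<Rightarrow> 'a set" where
  "module_generated R S = is_submodule R hull S"

end

theory Submission
  imports Defs
begin

text \<open>Order the exponent vectors by the sum of the squares of their entries. If some \<open>v \<ge> 1\<close> is
  skipped by the entries of \<open>d\<close>, although larger entries occur, lower by one the entries on the set
  \<open>S = {i. d i > v}\<close>. The result \<open>d'\<close> has the same support as \<open>d\<close>, so the same groupoid elements
  act on both, and multiplying the orbit sum of \<open>d'\<close> by the elementary symmetric polynomial of
  degree \<open>|S|\<close> gives the orbit sum of \<open>d\<close> plus orbit sums of strictly smaller vectors. Hence the
  orbit sums of vectors without such gaps generate the invariant ring. Without gaps, at most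
  \<open>|X| + 1 - v\<close> entries are \<open>\<ge> v\<close>, so the degree is at most \<open>|X| + \<dots> + 2 + 1\<close>.

  The bound is attained for two variables and the groupoid of all local bijections except the
  transposition: every invariant of degree less than \<open>3\<close> is symmetric, but
  \<open>x\<^sub>0\<^sup>2x\<^sub>1\<close> is a non-symmetric invariant.\<close>

abbreviation "lookup \<equiv> Poly_Mapping.lookup"
abbreviation "keys \<equiv> Poly_Mapping.keys"
abbreviation "single \<equiv> Poly_Mapping.single"

section \<open>Renaming variables\<close>

text \<open>Since \<open>s\<close> is injective, no two exponents are added up: only the summand
  \<open>j = i\<close> reaches \<open>s i\<close>.\<close>

lemma lookup_rename_monom:
  assumes "bij s"
  shows "lookup (rename_monom s d) (s i) = lookup d i"
proof -
  have "lookup (rename_monom s d) (s i) = (\<Sum>j\<in>keys d. if j = i then lookup d j else 0)"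
    unfolding rename_monom_def lookup_sum
    by (rule sum.cong) (use assms in \<open>auto simp: lookup_single when_def dest: bij_is_inj injD\<close>)
  then show ?thesis by (simp add: in_keys_iff)
qed

lemma rename_monom_eqI:
  assumes "bij s" and "\<And>i. lookup e (s i) = lookup d i"
  shows "rename_monom s d = e"
proof (rule poly_mapping_eqI)
  fix x
  obtain i where "x = s i" using assms(1) by (metis bij_pointE)
  then show "lookup (rename_monom s d) x = lookup e x"
    using assms by (simp add: lookup_rename_monom)
qed

lemma rename_monom_cong:
  "(\<And>i. i \<in> keys d \<Longrightarrow> s i = t i) \<Longrightarrow> rename_monom s d = rename_monom t d"
  unfolding rename_monom_def by (rule sum.cong) auto

lemma keys_rename_monom: "bij s \<Longrightarrow> keys (rename_monom s d) = s ` keys d"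
proof (rule set_eqI)
  fix x assume s: "bij s"
  obtain i where "x = s i" using s by (metis bij_pointE)
  then show "x \<in> keys (rename_monom s d) \<longleftrightarrow> x \<in> s ` keys d"
    using s by (simp add: in_keys_iff lookup_rename_monom inj_image_mem_iff[OF bij_is_inj])
qed

lemma rename_monom_add:
  "bij s \<Longrightarrow> rename_monom s (a + b) = rename_monom s a + rename_monom s b"
  by (rule rename_monom_eqI) (auto simp: lookup_add lookup_rename_monom)

lemma rename_monom_comp:
  assumes "bij s" "bij t"
  shows "rename_monom s (rename_monom t d) = rename_monom (s \<circ> t) d"
  by (rule rename_monom_eqI[symmetric, OF bij_comp[OF assms(2,1)]])
     (simp add: assms lookup_rename_monom)

lemma rename_monom_id: "(\<And>i. i \<in> keys d \<Longrightarrow> s i = i) \<Longrightarrow> rename_monom s d = d"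
  using rename_monom_cong[of d s id] rename_monom_eqI[of id d d] by simp

lemma rename_monom_inverse:
  assumes "bij s"
  shows "rename_monom (inv s) (rename_monom s d) = d" "rename_monom s (rename_monom (inv s) d) = d"
  using assms
  by (simp_all add: rename_monom_comp bij_imp_bij_inv rename_monom_id
      inv_o_cancel[OF bij_is_inj] surj_iff[THEN iffD1, OF bij_is_surj])

lemma inj_rename_monom: "bij s \<Longrightarrow> inj (rename_monom s)"
  by (metis injI rename_monom_inverse(1))

lemma sum_rename_monom:
  assumes "s permutes X"
  shows "(\<Sum>i\<in>X. g (lookup (rename_monom s d) i)) = (\<Sum>i\<in>X. g (lookup d i))"
proof -
  have "(\<Sum>i\<in>X. g (lookup (rename_monom s d) i)) = (\<Sum>i\<in>X. g (lookup (rename_monom s d) (s i)))"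
    by (rule sum.permute[OF assms, unfolded o_def])
  then show ?thesis by (simp add: lookup_rename_monom permutes_bij[OF assms])
qed

lemma monom_degree_eq_sum:
  assumes "finite X" "keys d \<subseteq> X"
  shows "monom_degree d = (\<Sum>i\<in>X. lookup d i)"
  unfolding monom_degree_def
  by (rule sum.mono_neutral_left) (use assms in \<open>auto simp: in_keys_iff\<close>)

lemma monom_degree_rename_monom:
  assumes "bij s"
  shows "monom_degree (rename_monom s d) = monom_degree d"
proof -
  have "inj_on s (keys d)" using assms by (meson bij_is_inj inj_on_subset subset_UNIV)
  then show ?thesis
    by (simp add: monom_degree_def keys_rename_monom assms sum.reindex lookup_rename_monom)
qed

lemma lookup_rename_poly:
  assumes "bij s"
  shows "lookup (rename_poly s p) (rename_monom s d) = lookup p d"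
proof -
  have "lookup (rename_poly s p) (rename_monom s d)
    = (\<Sum>e\<in>keys p. if e = d then lookup p e else 0)"
    unfolding rename_poly_def lookup_sum
    by (rule sum.cong) (auto simp: lookup_single when_def dest: injD[OF inj_rename_monom[OF assms]])
  then show ?thesis by (simp add: in_keys_iff)
qed

text \<open>Reduces symmetry to a condition on coefficients. Every exponent vector is a renaming of
  another one by \<open>s\<close>, because \<open>inv s\<close> can be applied first.\<close>

lemma rename_poly_eq_iff:
  assumes "bij s"
  shows "rename_poly s p = p \<longleftrightarrow> (\<forall>d. lookup p (rename_monom s d) = lookup p d)"
proof
  assume "rename_poly s p = p"
  then show "\<forall>d. lookup p (rename_monom s d) = lookup p d"
    using lookup_rename_poly[OF assms, of p] by simp
next
  assume *: "\<forall>d. lookup p (rename_monom s d) = lookup p d"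
  show "rename_poly s p = p"
  proof (rule poly_mapping_eqI)
    fix d
    show "lookup (rename_poly s p) d = lookup p d"
      using * lookup_rename_poly[OF assms, of p "rename_monom (inv s) d"]
      by (metis assms rename_monom_inverse(2))
  qed
qed

lemma symmetric_polys_iff:
  "p \<in> symmetric_polys X \<longleftrightarrow>
     p \<in> polys_in X \<and> (\<forall>s. s permutes X \<longrightarrow> (\<forall>d. lookup p (rename_monom s d) = lookup p d))"
  unfolding symmetric_polys_def by (simp add: rename_poly_eq_iff permutes_bij cong: conj_cong imp_cong)

section \<open>Coefficients of products\<close>

lemma sum_single_lookup: "(\<Sum>a\<in>keys p. single a (lookup p a)) = p"
  by (rule poly_mapping_eqI) (simp add: lookup_sum lookup_single when_def in_keys_iff)

lemma lookup_times:
  fixes p q :: "'a::monoid_add \<Rightarrow>\<^sub>0 'b::semiring_0"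
  shows "lookup (p * q) d =
    (\<Sum>(a, b) | a \<in> keys p \<and> b \<in> keys q \<and> a + b = d. lookup p a * lookup q b)"
proof -
  have "p * q = (\<Sum>a\<in>keys p. \<Sum>b\<in>keys q. single (a + b) (lookup p a * lookup q b))"
    using sum_product[of "\<lambda>a. single a (lookup p a)" "keys p" "\<lambda>b. single b (lookup q b)" "keys q"]
    by (simp add: sum_single_lookup mult_single)
  then have "lookup (p * q) d =
      (\<Sum>(a, b) \<in> keys p \<times> keys q. if a + b = d then lookup p a * lookup q b else 0)"
    by (simp add: lookup_sum lookup_single when_def flip: sum.cartesian_product)
  also have "\<dots> = (\<Sum>(a, b) | a \<in> keys p \<and> b \<in> keys q \<and> a + b = d. lookup p a * lookup q b)"
    by (rule sum.mono_neutral_cong_right) (auto intro: finite_subset[of _ "keys p \<times> keys q"] split: if_splits)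
  finally show ?thesis .
qed

lemma lookup_const_times: "lookup (single 0 c * p) d = c * lookup (p :: ('x, 'k::semiring_0) mpoly) d"
proof -
  have "single 0 c * p = (\<Sum>a\<in>keys p. single a (c * lookup p a))"
    using sum_distrib_left[of "single 0 c" "\<lambda>a. single a (lookup p a)" "keys p"]
    by (simp add: sum_single_lookup mult_single)
  then show ?thesis by (simp add: lookup_sum lookup_single when_def in_keys_iff)
qed

lemma keys_add_nat: "keys (a + b :: 'x \<Rightarrow>\<^sub>0 nat) = keys a \<union> keys b"
  by (auto simp: in_keys_iff lookup_add)

text \<open>Natural exponents cannot cancel, so in a decomposition \<open>a + b = d\<close> both
  parts have their support in \<open>keys d\<close>. Symmetry of the factors is therefore required
  only there, which fits maps acting on part of the variables. Renaming by \<open>s\<close> and by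
  \<open>inv s\<close> matches the decompositions of \<open>d\<close> with those of
  \<open>rename_monom s d\<close>.\<close>

lemma lookup_times_rename_monom:
  fixes p q :: "('x, 'k::semiring_0) mpoly"
  assumes s: "bij s"
    and p: "\<And>a. keys a \<subseteq> keys d \<Longrightarrow> lookup p (rename_monom s a) = lookup p a"
    and q: "\<And>a. keys a \<subseteq> keys d \<Longrightarrow> lookup q (rename_monom s a) = lookup q a"
  shows "lookup (p * q) (rename_monom s d) = lookup (p * q) d"
proof -
  let ?r = "rename_monom s" and ?r' = "rename_monom (inv s)"
  let ?D = "\<lambda>d. {(a, b). a \<in> keys p \<and> b \<in> keys q \<and> a + b = d}"
  have s': "bij (inv s)" using s by (rule bij_imp_bij_inv)
  have fwd: "(?r a, ?r b) \<in> ?D (?r d) \<and> lookup p (?r a) * lookup q (?r b) = lookup p a * lookup q b"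
    if "(a, b) \<in> ?D d" for a b
  proof -
    have "keys a \<subseteq> keys d" "keys b \<subseteq> keys d" using that by (auto simp: keys_add_nat)
    then show ?thesis using that p q by (auto simp: in_keys_iff rename_monom_add[OF s])
  qed
  \<comment> \<open>The assumptions on coefficients concern vectors supported in
    \<open>keys d\<close>, so they are applied after pulling \<open>a\<close> and \<open>b\<close>
    back.\<close>
  have bwd: "(?r' a, ?r' b) \<in> ?D d" if "(a, b) \<in> ?D (?r d)" for a b
  proof -
    have d: "?r' a + ?r' b = d"
      using that rename_monom_add[OF s', of a b] by (simp add: rename_monom_inverse[OF s])
    then have "keys (?r' a) \<subseteq> keys d" "keys (?r' b) \<subseteq> keys d" by (auto simp: keys_add_nat)
    with p[of "?r' a"] q[of "?r' b"] that d show ?thesis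
      by (simp add: in_keys_iff rename_monom_inverse[OF s])
  qed
  have "(\<Sum>(a, b)\<in>?D d. lookup p a * lookup q b) = (\<Sum>(a, b)\<in>?D (?r d). lookup p a * lookup q b)"
    by (rule sum.reindex_bij_witness[where i = "\<lambda>(a, b). (?r' a, ?r' b)" and j = "\<lambda>(a, b). (?r a, ?r b)"])
       (use fwd bwd in \<open>auto simp: rename_monom_inverse[OF s]\<close>)
  then show ?thesis by (simp add: lookup_times)
qed

lemma polys_in_times: "p \<in> polys_in X \<Longrightarrow> q \<in> polys_in X \<Longrightarrow> p * q \<in> polys_in X"
  for p q :: "('x, 'k::semiring_0) mpoly"
proof -
  assume *: "p \<in> polys_in X" "q \<in> polys_in X"
  have "keys d \<subseteq> X" if d: "d \<in> keys (p * q)" for d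
  proof -
    obtain a b where "d = a + b" "a \<in> keys p" "b \<in> keys q"
      using d keys_mult[of p q] by blast
    with * show ?thesis by (auto simp: polys_in_def keys_add_nat)
  qed
  then show ?thesis by (auto simp: polys_in_def)
qed

lemma polys_in_add: "p \<in> polys_in X \<Longrightarrow> q \<in> polys_in X \<Longrightarrow> p + q \<in> polys_in X"
  for p q :: "('x, 'k::monoid_add) mpoly"
  using keys_add[of p q] by (auto simp: polys_in_def)

lemma polys_in_const: "single 0 c \<in> polys_in X"
  by (simp add: polys_in_def)

lemma lookup_const_rename_monom:
  assumes "bij s"
  shows "lookup (single 0 c) (rename_monom s d) = lookup (single 0 c) d"
  using keys_rename_monom[OF assms, of d] assms
  by (auto simp: lookup_single when_def simp flip: keys_eq_empty)

section \<open>Permutations representing groupoid elements\<close>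

text \<open>\<open>dom f\<close> and \<open>ran f\<close> have equal size inside the finite set
  \<open>X\<close>, hence so do their complements; any bijection \<open>h\<close> between the
  complements completes \<open>f\<close>.\<close>

lemma local_bijection_extend:
  assumes "finite X" "local_bijection X f"
  obtains s where "s permutes X" "\<And>i. i \<in> dom f \<Longrightarrow> f i = Some (s i)"
proof -
  have sub: "dom f \<subseteq> X" "ran f \<subseteq> X" and inj: "inj_on f (dom f)"
    using assms(2) by (auto simp: local_bijection_def)
  have bij: "bij_betw (the \<circ> f) (dom f) (ran f)"
    unfolding bij_betw_def
  proof
    show "inj_on (the \<circ> f) (dom f)"
      using inj by (auto simp: inj_on_def dom_def)
    show "(the \<circ> f) ` dom f = ran f"
      by (force simp: ran_def dom_def)
  qed
  have fin: "finite (dom f)" "finite (ran f)"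
    using sub assms(1) finite_subset by blast+
  have "card (X - dom f) = card (X - ran f)"
    using bij_betw_same_card[OF bij] sub assms(1) fin by (simp add: card_Diff_subset)
  then obtain h where h: "bij_betw h (X - dom f) (X - ran f)"
    using assms(1) by (metis finite_Diff finite_same_card_bij)
  define s where "s x = (if x \<in> dom f then the (f x) else if x \<in> X then h x else x)" for x
  have "bij_betw s (dom f) (ran f)"
    using bij by (rule bij_betw_cong[THEN iffD1, rotated]) (simp add: s_def)
  moreover have "bij_betw s (X - dom f) (X - ran f)"
    using h by (rule bij_betw_cong[THEN iffD1, rotated]) (auto simp: s_def)
  ultimately have "bij_betw s (dom f \<union> (X - dom f)) (ran f \<union> (X - ran f))"
    by (rule bij_betw_combine) auto
  moreover have "dom f \<union> (X - dom f) = X" "ran f \<union> (X - ran f) = X" using sub by auto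
  ultimately have "s permutes X"
    using sub by (intro bij_imp_permutes) (auto simp: s_def)
  then show ?thesis by (rule that) (auto simp: s_def)
qed

section \<open>Elementary symmetric polynomials\<close>

text \<open>The exponent vector of the squarefree monomial with variable set
  \<open>T\<close>.\<close>

definition ind :: "'x set \<Rightarrow> 'x \<Rightarrow>\<^sub>0 nat" where
  "ind T = (\<Sum>i\<in>T. single i 1)"

lemma lookup_ind: "finite T \<Longrightarrow> lookup (ind T) i = (if i \<in> T then 1 else 0)"
  by (simp add: ind_def lookup_sum lookup_single when_def)

lemma keys_ind: "finite T \<Longrightarrow> keys (ind T) = T"
  by (auto simp: in_keys_iff lookup_ind split: if_splits)

lemma rename_monom_ind:
  assumes "bij s" "finite T"
  shows "rename_monom s (ind T) = ind (s ` T)"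
  using assms by (intro rename_monom_eqI) (auto simp: lookup_ind inj_image_mem_iff bij_is_inj)

definition esym :: "'x set \<Rightarrow> nat \<Rightarrow> ('x, 'k::comm_semiring_1) mpoly" where
  "esym X k = (\<Sum>T | T \<subseteq> X \<and> card T = k. single (ind T) 1)"

text \<open>A squarefree monomial determines its variable set, so at most one summand contributes,
  whatever the characteristic.\<close>

lemma lookup_esym:
  assumes "finite X"
  shows "lookup (esym X k) d =
    (if keys d \<subseteq> X \<and> card (keys d) = k \<and> (\<forall>i. lookup d i \<le> 1) then 1 else 0)"
proof -
  have ind: "ind T = d \<longleftrightarrow> T = keys d \<and> (\<forall>i. lookup d i \<le> 1)" if "T \<subseteq> X" for T
  proof
    have "finite T" using that assms finite_subset by blast
    then show "ind T = d \<Longrightarrow> T = keys d \<and> (\<forall>i. lookup d i \<le> 1)"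
      by (auto simp: keys_ind lookup_ind)
    assume *: "T = keys d \<and> (\<forall>i. lookup d i \<le> 1)"
    show "ind T = d"
    proof (rule poly_mapping_eqI)
      fix i
      from * have le: "lookup d i \<le> 1" by blast
      with * show "lookup (ind T) i = lookup d i"
        using \<open>finite T\<close> le le_antisym[OF le] by (cases "lookup d i = 0") (auto simp: lookup_ind in_keys_iff)
    qed
  qed
  have fin: "finite {T. T \<subseteq> X \<and> card T = k}" using assms by simp
  have "lookup (esym X k) d = (\<Sum>T | T \<subseteq> X \<and> card T = k.
      if T = keys d then if \<forall>i. lookup d i \<le> 1 then 1 else 0 else 0)"
    unfolding esym_def lookup_sum
    by (rule sum.cong) (auto simp: lookup_single when_def ind)
  also have "\<dots> = (if keys d \<subseteq> X \<and> card (keys d) = k \<and> (\<forall>i. lookup d i \<le> 1) then 1 else 0)"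
    using fin by (subst sum.delta) auto
  finally show ?thesis .
qed

lemma esym_symmetric:
  assumes "finite X"
  shows "(esym X k :: ('x, 'k::comm_semiring_1) mpoly) \<in> symmetric_polys X"
  unfolding symmetric_polys_iff
proof (intro conjI allI impI)
  show "(esym X k :: ('x, 'k) mpoly) \<in> polys_in X"
    unfolding polys_in_def
    by (auto simp: in_keys_iff[where s = "esym X k"] lookup_esym[OF assms] split: if_splits)
  fix s :: "'x \<Rightarrow> 'x" and d
  assume s: "s permutes X"
  then have b: "bij s" by (rule permutes_bij)
  have "(\<forall>i. lookup (rename_monom s d) i \<le> 1) \<longleftrightarrow> (\<forall>i. lookup d i \<le> 1)"
    using b by (metis bij_pointE lookup_rename_monom)
  moreover have "card (s ` keys d) = card (keys d)"
    using b by (meson bij_is_inj card_image inj_on_subset subset_UNIV)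
  moreover have "s ` keys d \<subseteq> X \<longleftrightarrow> keys d \<subseteq> X"
    using permutes_in_image[OF s] by auto
  ultimately show "lookup (esym X k :: ('x, 'k) mpoly) (rename_monom s d) = lookup (esym X k) d"
    by (simp add: lookup_esym[OF assms] keys_rename_monom[OF b])
qed

lemma esym_homogeneous:
  assumes "finite X"
  shows "homogeneous k (esym X k :: ('x, 'k::comm_semiring_1) mpoly)"
  unfolding homogeneous_def
proof
  fix d assume "d \<in> keys (esym X k :: ('x, 'k) mpoly)"
  then have *: "card (keys d) = k" "\<And>i. lookup d i \<le> 1"
    by (auto simp: in_keys_iff lookup_esym[OF assms] split: if_splits)
  have "lookup d i = 1" if "i \<in> keys d" for i
    using *(2)[of i] that by (simp add: in_keys_iff)
  then show "monom_degree d = k" using *(1) by (simp add: monom_degree_def)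
qed

section \<open>The leading orbit of a product with an elementary symmetric polynomial\<close>

definition sum_squares :: "'x set \<Rightarrow> ('x \<Rightarrow>\<^sub>0 nat) \<Rightarrow> nat" where
  "sum_squares X d = (\<Sum>i\<in>X. (lookup d i)\<^sup>2)"

lemma sum_squares_rename_monom: "s permutes X \<Longrightarrow> sum_squares X (rename_monom s d) = sum_squares X d"
  unfolding sum_squares_def by (rule sum_rename_monom)

text \<open>Raising the entries on \<open>T\<close> by one increases the sum of squares by twice the
  sum of \<open>c\<close> over \<open>T\<close>, plus \<open>card T\<close>. Among sets of a given
  size this is largest exactly on the upper level set \<open>U\<close>, since all entries outside
  \<open>U\<close> are below \<open>v\<close>.\<close>

lemma sum_squares_add_ind_less:
  assumes "finite X" "T \<subseteq> X" "card T = card U" "T \<noteq> U"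
    and U: "U = {i \<in> X. v \<le> lookup c i}"
  shows "sum_squares X (c + ind T) < sum_squares X (c + ind U)"
proof -
  have fin: "finite T" "finite U" using assms finite_subset by auto
  have UX: "U \<subseteq> X" using U by auto
  \<comment> \<open>Since \<open>T\<close> and \<open>U\<close> have the same cardinality, the terms \<open>2 v\<close> added on either side cancel
    after summation; they turn the comparison into a pointwise one.\<close>
  define t u where "t i = lookup (ind T) i" and "u i = lookup (ind U) i" for i
  have le: "(lookup c i + t i)\<^sup>2 + 2 * v * u i \<le> (lookup c i + u i)\<^sup>2 + 2 * v * t i"
    and less: "t i \<noteq> u i \<Longrightarrow>
      (lookup c i + t i)\<^sup>2 + 2 * v * u i < (lookup c i + u i)\<^sup>2 + 2 * v * t i" if "i \<in> X" for i
    using that fin U by (auto simp: t_def u_def lookup_ind power2_eq_square)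
  from \<open>T \<noteq> U\<close> obtain j where j: "j \<in> T \<longleftrightarrow> j \<notin> U" by blast
  with \<open>T \<subseteq> X\<close> UX have "j \<in> X" by blast
  moreover have "t j \<noteq> u j" using j fin by (auto simp: t_def u_def lookup_ind)
  ultimately have "(\<Sum>i\<in>X. (lookup c i + t i)\<^sup>2 + 2 * v * u i) < (\<Sum>i\<in>X. (lookup c i + u i)\<^sup>2 + 2 * v * t i)"
    using le less by (intro sum_strict_mono_ex1 assms(1)) auto
  moreover have "(\<Sum>i\<in>X. t i) = card T" "(\<Sum>i\<in>X. u i) = card U"
    using \<open>T \<subseteq> X\<close> UX fin assms(1) by (simp_all add: t_def u_def lookup_ind flip: sum.inter_restrict)
       (simp_all add: Int_absorb1)
  ultimately show ?thesis
    using \<open>card T = card U\<close>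
    by (simp add: sum_squares_def lookup_add t_def u_def sum.distrib flip: sum_distrib_left)
qed

text \<open>Renaming with a global permutation instead of a partial map avoids junk values of
  \<open>the \<circ> f\<close> and makes all renamings invertible.\<close>

definition representatives :: "'x set \<Rightarrow> ('x \<rightharpoonup> 'x) set \<Rightarrow> 'x set \<Rightarrow> ('x \<Rightarrow> 'x) set" where
  "representatives X G K = {s. s permutes X \<and> (Some \<circ> s) |` K \<in> G}"

lemma dom_Some_restrict [simp]: "dom ((Some \<circ> s) |` K) = K"
  by (auto simp: dom_def restrict_map_def)

lemma ran_Some_restrict [simp]: "ran ((Some \<circ> s) |` K) = s ` K"
  by (auto simp: ran_def restrict_map_def)

locale finite_permutation_groupoid =
  fixes X :: "'x set" and G :: "('x \<rightharpoonup> 'x) set"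
  assumes finite_X: "finite X" and groupoid: "permutation_groupoid X G"
begin

abbreviation "reps \<equiv> representatives X G"

lemma restrict_in: "f \<in> G \<Longrightarrow> A \<subseteq> dom f \<Longrightarrow> f |` A \<in> G"
  using groupoid by (auto simp: permutation_groupoid_def)

lemma comp_in: "f \<in> G \<Longrightarrow> g \<in> G \<Longrightarrow> ran g = dom f \<Longrightarrow> f \<circ>\<^sub>m g \<in> G"
  using groupoid by (auto simp: permutation_groupoid_def)

lemma reps_bij: "s \<in> reps K \<Longrightarrow> bij s"
  by (auto simp: representatives_def permutes_bij)

lemma reps_subset:
  assumes "s \<in> reps K" "L \<subseteq> K"
  shows "s \<in> reps L"
proof -
  have "((Some \<circ> s) |` K) |` L \<in> G"
    by (rule restrict_in) (use assms in \<open>auto simp only: representatives_def dom_Some_restrict\<close>)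
  moreover have "K \<inter> L = L" using assms(2) by blast
  ultimately show ?thesis using assms
    by (simp add: representatives_def)
qed

lemma id_reps:
  assumes "K \<subseteq> X"
  shows "id \<in> reps K"
proof -
  have "id \<in> reps X"
    using groupoid by (simp add: representatives_def permutation_groupoid_def)
  then show ?thesis using assms by (rule reps_subset)
qed

text \<open>Groupoid composition demands that the range of the inner map be exactly the domain of
  the outer one; hence \<open>t\<close> is taken over the image of \<open>K\<close> under
  \<open>s\<close>.\<close>

lemma reps_comp:
  assumes "s \<in> reps K" "t \<in> reps (s ` K)"
  shows "t \<circ> s \<in> reps K"
proof -
  have "(Some \<circ> t) |` (s ` K) \<circ>\<^sub>m (Some \<circ> s) |` K \<in> G"
    by (rule comp_in) (use assms in \<open>auto simp only: representatives_def dom_Some_restrict ran_Some_restrict\<close>)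
  moreover have "(Some \<circ> t) |` (s ` K) \<circ>\<^sub>m (Some \<circ> s) |` K = (Some \<circ> (t \<circ> s)) |` K"
    by (auto simp: fun_eq_iff map_comp_def restrict_map_def)
  ultimately show ?thesis
    using assms by (simp add: representatives_def permutes_compose)
qed

lemma reps_inverse:
  assumes "s \<in> reps K"
  shows "inv s \<in> reps (s ` K)"
proof -
  let ?f = "(Some \<circ> s) |` K"
  have s: "bij s" using assms by (rule reps_bij)
  then have "inj_on ?f (dom ?f)"
    by (auto simp: inj_on_def dest: bij_is_inj injD)
  then have "map_inverse ?f y = Some x \<longleftrightarrow> ((Some \<circ> inv s) |` (s ` K)) y = Some x" for x y
  proof -
    have "map_inverse ?f y = Some x \<longleftrightarrow> x \<in> K \<and> s x = y"
      using \<open>inj_on ?f (dom ?f)\<close> by (subst map_inverse_eq_Some_iff) (auto simp: restrict_map_def)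
    also have "\<dots> \<longleftrightarrow> y \<in> s ` K \<and> inv s y = x"
      using s by (metis bij_inv_eq_iff image_iff)
    finally show ?thesis by (auto simp: restrict_map_def)
  qed
  then have "map_inverse ?f = (Some \<circ> inv s) |` (s ` K)"
    by (metis ext option.exhaust)
  moreover have "map_inverse ?f \<in> G"
    using assms groupoid by (simp add: permutation_groupoid_def representatives_def)
  ultimately show ?thesis
    using assms by (simp add: representatives_def permutes_inv)
qed

section \<open>Orbits\<close>

lemma monom_orbit_eq: "monom_orbit G d = {rename_monom s d | s. s \<in> reps (keys d)}"
proof (intro set_eqI iffI)
  fix e assume "e \<in> monom_orbit G d"
  then obtain f where f: "f \<in> G" "keys d \<subseteq> dom f" "e = rename_monom (the \<circ> f) d"
    by (auto simp: monom_orbit_def)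
  have "local_bijection X f" using f(1) groupoid by (auto simp: permutation_groupoid_def)
  then obtain s where s: "s permutes X" "\<And>i. i \<in> dom f \<Longrightarrow> f i = Some (s i)"
    using local_bijection_extend[OF finite_X] by blast
  \<comment> \<open>Representatives have the support itself as their domain, so \<open>f\<close> is
    first cut down to it.\<close>
  have "f |` keys d = (Some \<circ> s) |` keys d"
    proof
    fix i show "(f |` keys d) i = ((Some \<circ> s) |` keys d) i"
      using s(2)[of i] f(2) by (cases "i \<in> keys d") auto
  qed
  moreover have "f |` keys d \<in> G" using f groupoid by (auto simp: permutation_groupoid_def)
  moreover have "e = rename_monom s d"
    unfolding f(3) using s(2) f(2) by (intro rename_monom_cong) (metis comp_apply option.sel subsetD)
  ultimately show "e \<in> {rename_monom s d | s. s \<in> reps (keys d)}"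
    using s(1) by (auto simp: representatives_def)
next
  fix e assume "e \<in> {rename_monom s d | s. s \<in> reps (keys d)}"
  then obtain s where s: "s \<in> reps (keys d)" "e = rename_monom s d" by blast
  have "e = rename_monom (the \<circ> (Some \<circ> s) |` keys d) d"
    unfolding s(2) by (rule rename_monom_cong) simp
  then show "e \<in> monom_orbit G d"
    using s(1) by (auto simp: monom_orbit_def representatives_def intro!: exI[of _ "(Some \<circ> s) |` keys d"])
qed

lemma finite_monom_orbit: "finite (monom_orbit G d)"
proof (rule finite_subset)
  show "monom_orbit G d \<subseteq> (\<lambda>s. rename_monom s d) ` {s. s permutes X}"
    by (auto simp: monom_orbit_eq representatives_def)
qed (simp add: finite_permutations finite_X)

lemma monom_orbit_refl: "keys d \<subseteq> X \<Longrightarrow> d \<in> monom_orbit G d"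
  using id_reps[of "keys d"] rename_monom_id[of d id] by (force simp: monom_orbit_eq)

lemma keys_monom_orbit:
  assumes "e \<in> monom_orbit G d" "keys d \<subseteq> X"
  shows "keys e \<subseteq> X"
proof -
  obtain s where "s permutes X" "e = rename_monom s d"
    using assms by (auto simp: monom_orbit_eq representatives_def)
  then show ?thesis
    using assms(2) permutes_image[of s X] by (auto simp: keys_rename_monom permutes_bij)
qed

lemma monom_orbit_trans:
  assumes "e \<in> monom_orbit G d" "s \<in> reps (keys e)"
  shows "rename_monom s e \<in> monom_orbit G d"
proof -
  obtain t where t: "t \<in> reps (keys d)" "e = rename_monom t d"
    using assms by (auto simp: monom_orbit_eq)
  then have "s \<circ> t \<in> reps (keys d)"
    using assms by (intro reps_comp) (auto simp: keys_rename_monom reps_bij)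
  moreover have "rename_monom s e = rename_monom (s \<circ> t) d"
    using t assms by (simp add: rename_monom_comp reps_bij)
  ultimately show ?thesis by (auto simp: monom_orbit_eq)
qed

lemma rename_monom_orbit_iff:
  assumes "s \<in> reps (keys e)"
  shows "rename_monom s e \<in> monom_orbit G d \<longleftrightarrow> e \<in> monom_orbit G d"
proof
  assume *: "rename_monom s e \<in> monom_orbit G d"
  have "inv s \<in> reps (keys (rename_monom s e))"
    using reps_inverse[OF assms] by (simp add: keys_rename_monom reps_bij[OF assms])
  from monom_orbit_trans[OF * this] show "e \<in> monom_orbit G d"
    by (simp add: rename_monom_inverse reps_bij[OF assms])
qed (rule monom_orbit_trans[OF _ assms])

lemma lookup_orbit_sum: "lookup (orbit_sum G d) e = (if e \<in> monom_orbit G d then 1 else 0)"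
  by (simp add: orbit_sum_def lookup_sum lookup_single when_def finite_monom_orbit)

lemma keys_orbit_sum: "keys (orbit_sum G d :: ('x, 'k::field) mpoly) = monom_orbit G d"
  by (auto simp: in_keys_iff lookup_orbit_sum split: if_splits)

section \<open>The invariant ring by coefficients\<close>

text \<open>A condition on coefficients is easier to check for products than membership in the span
  of the orbit sums; \<open>invariant_ring_eq\<close> shows that the two agree.\<close>

definition invariant :: "('x, 'k::zero) mpoly \<Rightarrow> bool" where
  "invariant p \<longleftrightarrow> p \<in> polys_in X \<and>
     (\<forall>d. \<forall>s\<in>reps (keys d). lookup p (rename_monom s d) = lookup p d)"

lemma invariant_orbit_sum:
  "keys d \<subseteq> X \<Longrightarrow> invariant (orbit_sum G d :: ('x, 'k::field) mpoly)"
  by (auto simp: invariant_def polys_in_def keys_orbit_sum lookup_orbit_sum rename_monom_orbit_iff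
      dest: keys_monom_orbit)

lemma invariant_add: "invariant p \<Longrightarrow> invariant q \<Longrightarrow> invariant (p + q)"
  for p q :: "('x, 'k::field) mpoly"
  by (simp add: invariant_def polys_in_add lookup_add)

text \<open>A groupoid element acting on the support of \<open>d\<close> also acts, by restriction,
  on the supports of both parts of a decomposition of \<open>d\<close>, so
  \<open>lookup_times_rename_monom\<close> applies.\<close>

lemma invariant_times: "invariant p \<Longrightarrow> invariant q \<Longrightarrow> invariant (p * q)"
  for p q :: "('x, 'k::field) mpoly"
  unfolding invariant_def
  by (auto intro!: polys_in_times lookup_times_rename_monom dest: reps_bij)
     (meson reps_subset)+

lemma invariant_const: "invariant (single 0 c :: ('x, 'k::field) mpoly)"
  by (simp add: invariant_def polys_in_const lookup_const_rename_monom reps_bij)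

lemma invariant_diff:
  fixes p q :: "('x, 'k::field) mpoly"
  assumes "invariant p" "invariant q"
  shows "invariant (p - q)"
proof -
  have "p - q = p + single 0 (-1) * q"
    by (rule poly_mapping_eqI) (simp add: lookup_minus lookup_add lookup_const_times)
  then show ?thesis
    using invariant_add[OF assms(1) invariant_times[OF invariant_const assms(2)]] by metis
qed

text \<open>Subtracting a multiple of one orbit sum removes a whole orbit of monomials and adds
  none, so the induction runs on the number of monomials. Only orbit sums of monomials of
  \<open>p\<close> itself are needed.\<close>

lemma invariant_in_subspace:
  fixes p :: "('x, 'k::field) mpoly"
  assumes M: "mpoly.subspace M" and "invariant p" and "\<And>d. d \<in> keys p \<Longrightarrow> orbit_sum G d \<in> M"
  shows "p \<in> M"
  using assms(2,3)
proof (induction "card (keys p)" arbitrary: p rule: less_induct)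
  case less
  show ?case
  proof (cases "p = 0")
    case True
    then show ?thesis using M by (simp add: mpoly.subspace_0)
  next
    case False
    then obtain d where d: "d \<in> keys p" by (metis keys_eq_empty all_not_in_conv)
    then have dX: "keys d \<subseteq> X" using less.prems(1) by (auto simp: invariant_def polys_in_def)
    let ?o = "single 0 (lookup p d) * orbit_sum G d"
    define q where "q = p - ?o"
    \<comment> \<open>By invariance the coefficient of \<open>p\<close> equals
      \<open>lookup p d\<close> on the whole orbit of \<open>d\<close>, so it is cleared
      there.\<close>
    have q: "lookup q e = (if e \<in> monom_orbit G d then 0 else lookup p e)" for e
      using less.prems(1)
      by (auto simp: q_def lookup_minus lookup_const_times lookup_orbit_sum monom_orbit_eq invariant_def)
    have "keys q \<subseteq> keys p" "d \<notin> keys q"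
      using monom_orbit_refl[OF dX] by (auto simp: in_keys_iff q split: if_splits)
    then have "card (keys q) < card (keys p)"
      using d by (intro psubset_card_mono) auto
    moreover have "invariant q"
      unfolding q_def using less.prems(1) dX
      by (intro invariant_diff invariant_times invariant_const invariant_orbit_sum)
    ultimately have "q \<in> M" using less.hyps less.prems(2) \<open>keys q \<subseteq> keys p\<close> by blast
    moreover have "?o \<in> M" using M less.prems(2)[OF d] by (rule mpoly.subspace_scale)
    ultimately have "q + ?o \<in> M" using M by (intro mpoly.subspace_add)
    then show ?thesis by (simp add: q_def)
  qed
qed

lemma invariant_ring_eq: "(invariant_ring X G :: ('x, 'k::field) mpoly set) = {p. invariant p}"
proof (intro set_eqI iffI)
  fix p :: "('x, 'k) mpoly"
  assume "p \<in> invariant_ring X G"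
  then have "p \<in> mpoly.span {orbit_sum G d | d. keys d \<subseteq> X}" by (simp add: invariant_ring_def)
  moreover have "mpoly.subspace {p :: ('x, 'k) mpoly. invariant p}"
    using invariant_const[of 0]
    by (auto intro!: mpoly.subspaceI invariant_add invariant_times invariant_const)
  ultimately have "p \<in> {p. invariant p}"
    using mpoly.span_minimal[of "{orbit_sum G d | d. keys d \<subseteq> X}" "{p :: ('x, 'k) mpoly. invariant p}"]
    by (auto intro: invariant_orbit_sum)
  then show "p \<in> {p. invariant p}" .
next
  fix p :: "('x, 'k) mpoly"
  assume p: "p \<in> {p. invariant p}"
  show "p \<in> invariant_ring X G"
    unfolding invariant_ring_def
  proof (rule invariant_in_subspace[OF mpoly.subspace_span])
    show "invariant p" using p by simp
    fix d assume "d \<in> keys p"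
    then show "orbit_sum G d \<in> mpoly.span {orbit_sum G d | d. keys d \<subseteq> X}"
      using p by (intro mpoly.span_base) (auto simp: invariant_def polys_in_def)
  qed
qed

lemma symmetric_polys_invariant:
  "p \<in> symmetric_polys X \<Longrightarrow> invariant (p :: ('x, 'k::field) mpoly)"
  by (auto simp: invariant_def symmetric_polys_iff representatives_def)


section \<open>Lowering the entries above a gap\<close>

lemma lookup_esym_times_orbit_sum:
  "lookup (esym X k * orbit_sum G a :: ('x, 'k::field) mpoly) b =
     (\<Sum>T | T \<subseteq> X \<and> card T = k. \<Sum>c\<in>monom_orbit G a. if ind T + c = b then 1 else 0)"
  by (simp add: esym_def orbit_sum_def sum_product mult_single lookup_sum lookup_single when_def)

context
  fixes d :: "'x \<Rightarrow>\<^sub>0 nat" and v :: nat and S :: "'x set" and d' :: "'x \<Rightarrow>\<^sub>0 nat"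
  assumes keys_d: "keys d \<subseteq> X" and v: "v \<ge> 1" and gap: "\<And>i. lookup d i \<noteq> v"
  defines "S \<equiv> {i. v < lookup d i}" and "d' \<equiv> d - ind S"
begin

lemma S_subset: "S \<subseteq> X"
  using keys_d by (auto simp: S_def in_keys_iff)

lemma finite_S: "finite S"
  using S_subset finite_X finite_subset by blast

lemma lookup_lowered: "lookup d' i = (if v < lookup d i then lookup d i - 1 else lookup d i)"
  by (simp add: d'_def lookup_minus lookup_ind finite_S) (simp add: S_def)

lemma lowered_add: "d' + ind S = d"
  by (rule poly_mapping_eqI) (auto simp: lookup_add lookup_lowered lookup_ind finite_S, auto simp: S_def)

text \<open>Because \<open>v\<close> is at least 1, every lowered entry was at least 2 and stays
  positive.\<close>

lemma keys_lowered: "keys d' = keys d"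
  using v by (auto simp: in_keys_iff lookup_lowered split: if_splits)

text \<open>This is where the gap is used: lowered entries stay at least \<open>v\<close>, and the
  others, being different from \<open>v\<close>, lie below it. So \<open>S\<close> can be recovered
  from \<open>d'\<close> as an upper level set.\<close>

lemma lowered_ge_iff: "v \<le> lookup d' i \<longleftrightarrow> v < lookup d i"
  using gap[of i] by (auto simp: lookup_lowered)

text \<open>As \<open>d\<close> and \<open>d'\<close> have the same support, the representative
  \<open>s\<close> carrying \<open>d'\<close> to \<open>c\<close> also acts on \<open>d\<close>, and
  it carries \<open>S\<close> to the upper level set of \<open>c\<close>. If \<open>T\<close> is
  that set, the product monomial is the renaming of \<open>d\<close>; any other \<open>T\<close>
  gives less by \<open>sum_squares_add_ind_less\<close>.\<close>

lemma orbit_lowered_cases: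
  assumes c: "c \<in> monom_orbit G d'" and T: "T \<subseteq> X" "card T = card S"
  obtains "T = {i. v \<le> lookup c i}" "ind T + c \<in> monom_orbit G d"
  | "sum_squares X (ind T + c) < sum_squares X d"
proof -
  obtain s where s: "s \<in> reps (keys d)" "c = rename_monom s d'"
    using c by (auto simp: monom_orbit_eq keys_lowered)
  have b: "bij s" and sX: "s permutes X" using s(1) by (auto simp: representatives_def permutes_bij)
  have U: "s ` S = {i. v \<le> lookup c i}"
  proof (rule set_eqI)
    fix x
    obtain i where "x = s i" using b by (metis bij_pointE)
    then show "x \<in> s ` S \<longleftrightarrow> x \<in> {i. v \<le> lookup c i}"
      using b by (simp add: s(2) lookup_rename_monom lowered_ge_iff inj_image_mem_iff bij_is_inj)
        (simp add: S_def)
  qed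
  have sub: "s ` S \<subseteq> X" using S_subset permutes_image[OF sX] by auto
  have card: "card (s ` S) = card S"
    using b by (meson bij_is_inj card_image inj_on_subset subset_UNIV)
  have top: "ind (s ` S) + c = rename_monom s d"
    using rename_monom_add[OF b, of d' "ind S"]
    by (simp add: lowered_add rename_monom_ind b finite_S s(2) add.commute)
  show thesis
  proof (cases "T = s ` S")
    case True
    then show thesis using that(1) U top s(1) by (auto simp: monom_orbit_eq)
  next
    case False
    have "sum_squares X (c + ind T) < sum_squares X (c + ind (s ` S))"
      using False T card finite_X sub U by (intro sum_squares_add_ind_less[of X T _ v]) auto
    also have "\<dots> = sum_squares X d"
      using top sX by (simp add: add.commute sum_squares_rename_monom)
    finally show thesis using that(2) by (simp add: add.commute)
  qed
qed

lemma sum_squares_lowered_less: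
  assumes "S \<noteq> {}"
  shows "sum_squares X d' < sum_squares X d"
  unfolding sum_squares_def
proof (rule sum_strict_mono_ex1[OF finite_X])
  show "\<forall>i\<in>X. (lookup d' i)\<^sup>2 \<le> (lookup d i)\<^sup>2"
    by (auto simp: lookup_lowered intro!: power_mono)
  obtain i where "i \<in> S" using assms by blast
  then have "i \<in> X" "(lookup d' i)\<^sup>2 < (lookup d i)\<^sup>2"
    using S_subset by (auto simp: lookup_lowered intro!: power_strict_mono) (auto simp: S_def)
  then show "\<exists>i\<in>X. (lookup d' i)\<^sup>2 < (lookup d i)\<^sup>2" by blast
qed

lemma lookup_leading_product:
  "lookup (esym X (card S) * orbit_sum G d' :: ('x, 'k::field) mpoly) d = 1"
proof -
  have iff: "ind T + c = d \<longleftrightarrow> T = S \<and> c = d'"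
    if T: "T \<subseteq> X" "card T = card S" and c: "c \<in> monom_orbit G d'" for T c
  proof
    assume d: "ind T + c = d"
    have fT: "finite T" using T finite_X finite_subset by blast
    \<comment> \<open>The other alternative would make \<open>sum_squares X d\<close> smaller than
      itself.\<close>
    have Tc: "T = {i. v \<le> lookup c i}"
      using orbit_lowered_cases[OF c T] d by (metis less_irrefl)
    \<comment> \<open>On \<open>T\<close> the entry of \<open>d\<close> is one more than an entry of
      \<open>c\<close> that is at least \<open>v\<close>; off \<open>T\<close> it is an entry of
      \<open>c\<close> below \<open>v\<close>.\<close>
    have "i \<in> T \<longleftrightarrow> i \<in> S" for i
    proof -
      have "lookup d i = (if i \<in> T then 1 else 0) + lookup c i"
        using fT by (simp flip: d add: lookup_add lookup_ind)
      then show ?thesis using Tc by (auto simp: S_def)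
    qed
    then have "T = S" by blast
    moreover have "c = d'" using d lowered_add \<open>T = S\<close> by (metis add.commute add_left_cancel)
    ultimately show "T = S \<and> c = d'" by blast
  qed (use lowered_add in \<open>auto simp: add.commute\<close>)
  have d': "d' \<in> monom_orbit G d'" using keys_d by (simp add: monom_orbit_refl keys_lowered)
  have "lookup (esym X (card S) * orbit_sum G d' :: ('x, 'k) mpoly) d =
     (\<Sum>T | T \<subseteq> X \<and> card T = card S. \<Sum>c\<in>monom_orbit G d'. if c = d' then if T = S then 1 else 0 else 0)"
    unfolding lookup_esym_times_orbit_sum by (intro sum.cong refl) (auto simp: iff)
  also have "\<dots> = 1"
    using finite_X S_subset d' by (simp add: finite_monom_orbit)
  finally show ?thesis .
qed

lemma keys_leading_product:
  assumes "b \<in> keys (esym X (card S) * orbit_sum G d' :: ('x, 'k::field) mpoly)"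
  shows "b \<in> monom_orbit G d \<or> sum_squares X b < sum_squares X d"
proof -
  obtain T c where "T \<subseteq> X" "card T = card S" "c \<in> monom_orbit G d'" "ind T + c = b"
  proof (rule ccontr)
    assume "\<not> thesis"
    with that have "lookup (esym X (card S) * orbit_sum G d' :: ('x, 'k) mpoly) b = 0"
      unfolding lookup_esym_times_orbit_sum by (intro sum.neutral ballI) auto
    with assms show False by (simp add: in_keys_iff)
  qed
  then show ?thesis using orbit_lowered_cases by metis
qed

end

lemma invariant_esym: "invariant (esym X k :: ('x, 'k::field) mpoly)"
  using esym_symmetric[OF finite_X] by (rule symmetric_polys_invariant)

section \<open>Generation by orbit sums of gap-free monomials\<close>

text \<open>The value \<open>0\<close> is exempt: closing a gap at \<open>0\<close> would turn
  entries \<open>1\<close> into \<open>0\<close> and shrink the support.\<close>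

definition gap_free :: "('x \<Rightarrow>\<^sub>0 nat) \<Rightarrow> bool" where
  "gap_free d \<longleftrightarrow> keys d \<subseteq> X \<and> (\<forall>v\<ge>1. (\<exists>i. v < lookup d i) \<longrightarrow> (\<exists>i. lookup d i = v))"

text \<open>Stated for an arbitrary subspace \<open>M\<close> so that one induction serves both the
  algebra and the module. The induction hypothesis is used twice: for the lowered vector, and for
  the monomials that remain once the orbit of \<open>d\<close> has been subtracted from the
  product.\<close>

lemma orbit_sum_in_subspace:
  fixes M :: "('x, 'k::field) mpoly set"
  assumes M: "mpoly.subspace M"
    and esym: "\<And>k p. 1 \<le> k \<Longrightarrow> k \<le> card X \<Longrightarrow> p \<in> M \<Longrightarrow> esym X k * p \<in> M"
    and base: "\<And>d. gap_free d \<Longrightarrow> orbit_sum G d \<in> M"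
    and "keys d \<subseteq> X"
  shows "orbit_sum G d \<in> M"
  using assms(4)
proof (induction "sum_squares X d" arbitrary: d rule: less_induct)
  case less
  show ?case
  proof (cases "gap_free d")
    case False
    then obtain v i where v: "v \<ge> 1" "v < lookup d i" "\<And>i. lookup d i \<noteq> v"
      using less.prems by (auto simp: gap_free_def)
    let ?S = "{i. v < lookup d i}"
    let ?d' = "d - ind ?S"
    note facts = less.prems v(1,3)
    have d': "keys ?d' \<subseteq> X" using keys_lowered[OF facts] less.prems by simp
    have S: "finite ?S" "?S \<noteq> {}" "?S \<subseteq> X" using finite_S[OF facts] S_subset[OF facts] v(2) by auto
    then have card: "1 \<le> card ?S" "card ?S \<le> card X"
      using finite_X by (auto simp: Suc_le_eq card_gt_0_iff card_mono)
    define p :: "('x, 'k) mpoly" where "p = esym X (card ?S) * orbit_sum G ?d'"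
    have "orbit_sum G ?d' \<in> M"
      using less.hyps d' sum_squares_lowered_less[OF facts S(2)] by blast
    then have pM: "p \<in> M" unfolding p_def using card by (intro esym)
    have pinv: "invariant p"
      unfolding p_def using d' by (intro invariant_times invariant_esym invariant_orbit_sum)
    have "p - orbit_sum G d \<in> M"
    proof (rule invariant_in_subspace[OF M])
      show "invariant (p - orbit_sum G d)"
        using pinv less.prems by (intro invariant_diff invariant_orbit_sum)
      fix b assume b: "b \<in> keys (p - orbit_sum G d)"
      \<comment> \<open>The product is invariant and has coefficient 1 at \<open>d\<close>, hence on
        the whole orbit of \<open>d\<close>, where the difference vanishes.\<close>
      have "b \<notin> monom_orbit G d"
      proof
        assume *: "b \<in> monom_orbit G d"
        then obtain s where "s \<in> reps (keys d)" "b = rename_monom s d" by (auto simp: monom_orbit_eq)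
        then have "lookup p b = 1"
          using pinv lookup_leading_product[OF facts] by (simp add: invariant_def p_def)
        with b * show False by (simp add: in_keys_iff lookup_minus lookup_orbit_sum)
      qed
      moreover from this have bp: "b \<in> keys p"
        using b by (simp add: in_keys_iff lookup_minus lookup_orbit_sum)
      ultimately have "sum_squares X b < sum_squares X d"
        using keys_leading_product[OF facts] unfolding p_def by blast
      moreover have "keys b \<subseteq> X" using bp pinv by (auto simp: invariant_def polys_in_def)
      ultimately show "orbit_sum G b \<in> M" by (rule less.hyps)
    qed
    from mpoly.subspace_diff[OF M pM this] show ?thesis by simp
  qed (rule base)
qed

section \<open>Degree and number of gap-free exponent vectors\<close>

text \<open>If some entry reaches \<open>v\<close>, then each of the values from \<open>1\<close> to
  \<open>v - 1\<close> occurs as well, which takes up at least \<open>v - 1\<close> indices with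
  entries below \<open>v\<close>.\<close>

lemma card_lookup_ge:
  assumes "gap_free d" "v \<ge> 1"
  shows "card {i \<in> X. v \<le> lookup d i} \<le> card X + 1 - v"
proof (cases "{i \<in> X. v \<le> lookup d i} = {}")
  case True
  then show ?thesis by (simp only: card.empty)
next
  case False
  then obtain j where j: "j \<in> X" "v \<le> lookup d j" by blast
  let ?L = "{i \<in> X. lookup d i < v}" and ?U = "{i \<in> X. v \<le> lookup d i}"
  have "{1..<v} \<subseteq> lookup d ` ?L"
  proof
    fix u assume u: "u \<in> {1..<v}"
    then obtain i where i: "lookup d i = u"
      using assms(1) j(2) unfolding gap_free_def by (metis atLeastLessThan_iff order_less_le_trans)
    then have "i \<in> X" using u assms(1) by (auto simp: gap_free_def in_keys_iff)
    then show "u \<in> lookup d ` ?L" using i u by auto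
  qed
  then have "card {1..<v} \<le> card ?L"
    by (rule surj_card_le[rotated]) (simp add: finite_X)
  moreover have "card X = card ?L + card ?U"
  proof -
    have "X = ?L \<union> ?U" by auto
    then show ?thesis
      by (subst card_Un_disjoint[symmetric]) (auto simp: finite_X)
  qed
  ultimately show ?thesis by simp
qed

lemma gap_free_lookup_le:
  assumes "gap_free d"
  shows "lookup d i \<le> card X"
proof (rule ccontr)
  assume *: "\<not> lookup d i \<le> card X"
  then have "i \<in> X" using assms by (auto simp: gap_free_def in_keys_iff)
  with * have "i \<in> {i \<in> X. card X + 1 \<le> lookup d i}" by auto
  \<comment> \<open>At level \<open>card X + 1\<close> the bound of \<open>card_lookup_ge\<close> is
    0.\<close>
  moreover have "card {i \<in> X. card X + 1 \<le> lookup d i} = 0"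
    using card_lookup_ge[OF assms, of "card X + 1"] by simp
  ultimately show False using finite_X by auto
qed

text \<open>Double counting: an entry is the number of levels it reaches, so the degree is the sum
  over the levels \<open>v\<close> of the number of entries that reach \<open>v\<close>.\<close>

lemma gap_free_monom_degree_le:
  assumes "gap_free d"
  shows "monom_degree d \<le> card X * (card X + 1) div 2"
proof -
  let ?n = "card X"
  have lookup: "lookup d i = (\<Sum>v=1..?n. if v \<le> lookup d i then 1 else 0)" for i
  proof -
    have "(\<Sum>v=1..?n. if v \<le> lookup d i then 1 else 0) = card {v \<in> {1..?n}. v \<le> lookup d i}"
      by (simp flip: sum.inter_filter)
    also have "{v \<in> {1..?n}. v \<le> lookup d i} = {1..lookup d i}"
      using gap_free_lookup_le[OF assms, of i] by auto
    finally show ?thesis by simp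
  qed
  have "monom_degree d = (\<Sum>i\<in>X. lookup d i)"
    using assms by (intro monom_degree_eq_sum finite_X) (simp add: gap_free_def)
  also have "\<dots> = (\<Sum>i\<in>X. \<Sum>v=1..?n. if v \<le> lookup d i then 1 else 0)"
    by (rule sum.cong[OF refl lookup])
  also have "\<dots> = (\<Sum>v=1..?n. \<Sum>i\<in>X. if v \<le> lookup d i then 1 else 0)"
    by (rule sum.swap)
  also have "\<dots> = (\<Sum>v=1..?n. card {i \<in> X. v \<le> lookup d i})"
    using finite_X by (simp flip: sum.inter_filter)
  also have "\<dots> \<le> (\<Sum>v=1..?n. ?n + 1 - v)"
    by (intro sum_mono card_lookup_ge[OF assms]) simp
  also have "\<dots> = (\<Sum>v=1..?n. v)"
    by (subst sum.atLeastAtMost_rev) simp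
  also have "\<dots> = ?n * (?n + 1) div 2"
    using gauss_sum_from_Suc_0[of ?n, where 'a = nat] by simp
  finally show ?thesis .
qed

lemma finite_gap_free: "finite {d. gap_free d}"
proof (rule finite_imageD)
  have "lookup ` {d. gap_free d} \<subseteq>
      {f. \<forall>x. (x \<in> X \<longrightarrow> f x \<in> {..card X}) \<and> (x \<notin> X \<longrightarrow> f x = 0)}"
    using gap_free_lookup_le by (auto simp: gap_free_def in_keys_iff)
  then show "finite (lookup ` {d. gap_free d})"
    by (rule finite_subset) (intro finite_set_of_finite_funs finite_X finite_atMost)
  show "inj_on lookup {d. gap_free d}"
    by (rule inj_onI) (rule poly_mapping_eq_iff[THEN iffD2])
qed

section \<open>The finite generating sets\<close>

lemma orbit_sum_homogeneous: "homogeneous (monom_degree d) (orbit_sum G d :: ('x, 'k::field) mpoly)"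
  by (auto simp: homogeneous_def keys_orbit_sum monom_orbit_eq monom_degree_rename_monom reps_bij)

definition generators :: "('x, 'k::field) mpoly set" where
  "generators = orbit_sum G ` {d. gap_free d}"

lemma generators:
  shows "finite (generators :: ('x, 'k::field) mpoly set)"
    and "(generators :: ('x, 'k) mpoly set) \<subseteq> invariant_ring X G"
    and "(p :: ('x, 'k) mpoly) \<in> generators \<Longrightarrow> \<exists>n \<le> card X * (card X + 1) div 2. homogeneous n p"
proof -
  show "finite (generators :: ('x, 'k) mpoly set)"
    by (simp add: generators_def finite_gap_free)
  show "(generators :: ('x, 'k) mpoly set) \<subseteq> invariant_ring X G"
    by (auto simp: generators_def invariant_ring_eq gap_free_def invariant_orbit_sum)
  show "p \<in> generators \<Longrightarrow> \<exists>n \<le> card X * (card X + 1) div 2. homogeneous n p"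
    using gap_free_monom_degree_le orbit_sum_homogeneous unfolding generators_def by blast
qed

text \<open>The common core of both generation statements: the generated algebra and the generated
  module are each a subspace closed under multiplication by elementary symmetric
  polynomials.\<close>

lemma invariant_ring_subset:
  fixes M :: "('x, 'k::field) mpoly set"
  assumes M: "mpoly.subspace M"
    and esym: "\<And>k p. 1 \<le> k \<Longrightarrow> k \<le> card X \<Longrightarrow> p \<in> M \<Longrightarrow> esym X k * p \<in> M"
    and base: "generators \<subseteq> M"
  shows "invariant_ring X G \<subseteq> M"
proof
  fix p :: "('x, 'k) mpoly"
  assume "p \<in> invariant_ring X G"
  then have p: "invariant p" by (simp add: invariant_ring_eq)
  show "p \<in> M"
  proof (rule invariant_in_subspace[OF M p])
    fix d assume "d \<in> keys p"
    then have "keys d \<subseteq> X" using p by (auto simp: invariant_def polys_in_def)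
    moreover have "orbit_sum G e \<in> M" if "gap_free e" for e
      using base that by (auto simp: generators_def)
    ultimately show "orbit_sum G d \<in> M"
      using orbit_sum_in_subspace[OF M esym] by blast
  qed
qed

lemma const_in_invariant_ring: "(single 0 c :: ('x, 'k::field) mpoly) \<in> invariant_ring X G"
  by (simp add: invariant_ring_eq invariant_const)

text \<open>An algebra has only constants as coefficients, so the elementary symmetric polynomials
  join the generators. The indices from 1 to \<open>card X\<close> suffice, because the reduction
  multiplies by no others.\<close>

lemma algebra_generated_invariant_ring:
  "algebra_generated (generators \<union> esym X ` {1..card X}) = (invariant_ring X G :: ('x, 'k::field) mpoly set)"
    (is "algebra_generated ?S = _")
proof
  have "is_subalgebra (invariant_ring X G :: ('x, 'k) mpoly set)"
    by (simp add: is_subalgebra_def invariant_ring_eq invariant_const invariant_add invariant_times)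
  then show "algebra_generated ?S \<subseteq> (invariant_ring X G :: ('x, 'k) mpoly set)"
    unfolding algebra_generated_def
    using generators(2) by (intro hull_minimal) (auto simp: invariant_ring_eq invariant_esym)
  \<comment> \<open>The hull has the closure properties itself, since they pass to
    intersections.\<close>
  have A: "is_subalgebra (algebra_generated ?S :: ('x, 'k) mpoly set)"
    unfolding algebra_generated_def by (rule hull_in) (auto simp: is_subalgebra_def)
  have S: "?S \<subseteq> (algebra_generated ?S :: ('x, 'k) mpoly set)"
    unfolding algebra_generated_def by (rule hull_subset)
  show "invariant_ring X G \<subseteq> (algebra_generated ?S :: ('x, 'k) mpoly set)"
  proof (rule invariant_ring_subset)
    show "mpoly.subspace (algebra_generated ?S :: ('x, 'k) mpoly set)"
    proof (rule mpoly.subspaceI)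
      have "single 0 0 \<in> (algebra_generated ?S :: ('x, 'k) mpoly set)"
        using A unfolding is_subalgebra_def by blast
      then show "0 \<in> (algebra_generated ?S :: ('x, 'k) mpoly set)" by simp
    qed (use A in \<open>auto simp: is_subalgebra_def\<close>)
    show "generators \<subseteq> (algebra_generated ?S :: ('x, 'k) mpoly set)" using S by auto
    show "esym X k * p \<in> algebra_generated ?S"
      if "1 \<le> k" "k \<le> card X" "p \<in> algebra_generated ?S" for k and p :: "('x, 'k) mpoly"
    proof -
      have "esym X k \<in> ?S" using that by auto
      then show ?thesis using S A that(3) unfolding is_subalgebra_def by blast
    qed
  qed
qed

lemma module_generated_invariant_ring:
  "module_generated (symmetric_polys X) generators = (invariant_ring X G :: ('x, 'k::field) mpoly set)"
    (is "module_generated ?R ?S = _")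
proof
  have "is_submodule ?R (invariant_ring X G :: ('x, 'k) mpoly set)"
    using const_in_invariant_ring[of 0]
    by (auto simp: is_submodule_def invariant_ring_eq symmetric_polys_invariant invariant_add invariant_times)
  then show "module_generated ?R ?S \<subseteq> (invariant_ring X G :: ('x, 'k) mpoly set)"
    unfolding module_generated_def using generators(2) by (intro hull_minimal) auto
  have A: "is_submodule ?R (module_generated ?R ?S :: ('x, 'k) mpoly set)"
    unfolding module_generated_def by (rule hull_in) (auto simp: is_submodule_def)
  have S: "?S \<subseteq> (module_generated ?R ?S :: ('x, 'k) mpoly set)"
    unfolding module_generated_def by (rule hull_subset)
  show "invariant_ring X G \<subseteq> (module_generated ?R ?S :: ('x, 'k) mpoly set)"
  proof (rule invariant_ring_subset)
    \<comment> \<open>Constants are symmetric, so scaling by the field is part of the module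
      action.\<close>
    have "single 0 c \<in> (symmetric_polys X :: ('x, 'k) mpoly set)" for c
      by (simp add: symmetric_polys_iff polys_in_const lookup_const_rename_monom permutes_bij)
    then show "mpoly.subspace (module_generated ?R ?S :: ('x, 'k) mpoly set)"
      using A unfolding is_submodule_def by (intro mpoly.subspaceI) blast+
    show "esym X k * p \<in> module_generated ?R ?S"
      if "p \<in> module_generated ?R ?S" for k and p :: "('x, 'k) mpoly"
      using that A esym_symmetric[OF finite_X] unfolding is_submodule_def by blast
  qed (rule S)
qed

end

section \<open>Tightness\<close>

text \<open>Used to confine a module generated by symmetric elements to the symmetric
  polynomials.\<close>

lemma is_submodule_symmetric_polys:
  "is_submodule (symmetric_polys X) (symmetric_polys X :: ('x, 'k::field) mpoly set)"
  unfolding is_submodule_def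
proof (intro conjI ballI)
  show "(0 :: ('x, 'k) mpoly) \<in> symmetric_polys X"
    by (simp add: symmetric_polys_iff polys_in_def)
  fix p q :: "('x, 'k) mpoly"
  assume "p \<in> symmetric_polys X" "q \<in> symmetric_polys X"
  then show "p + q \<in> symmetric_polys X" "p * q \<in> symmetric_polys X"
    by (auto simp: symmetric_polys_iff polys_in_add lookup_add
        intro!: polys_in_times lookup_times_rename_monom permutes_bij)
qed

text \<open>Monomials that miss a variable of \<open>Y\<close> see every permutation of
  \<open>Y\<close>, while those involving all variables are fixed. With two variables only the
  transposition is left out.\<close>

definition rigid_groupoid :: "'x set \<Rightarrow> ('x \<rightharpoonup> 'x) set" where
  "rigid_groupoid Y = {f. local_bijection Y f \<and> (dom f = Y \<longrightarrow> f = Some |` Y)}"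

lemma dom_map_inverse: "inj_on f (dom f) \<Longrightarrow> dom (map_inverse f) = ran f"
  by (auto simp: map_inverse_def dom_def split: if_splits)

lemma ran_map_inverse: "inj_on f (dom f) \<Longrightarrow> ran (map_inverse f) = dom f"
  by (auto simp: ran_def dom_def map_inverse_eq_Some_iff)

lemma local_bijection_map_inverse:
  assumes "local_bijection X f"
  shows "local_bijection X (map_inverse f)"
proof -
  have inj: "inj_on f (dom f)" using assms by (simp add: local_bijection_def)
  have "inj_on (map_inverse f) (dom (map_inverse f))"
  proof (rule inj_onI)
    fix x y assume "x \<in> dom (map_inverse f)" "map_inverse f x = map_inverse f y"
    then obtain z where "map_inverse f x = Some z" "map_inverse f y = Some z" by (metis domD)
    then show "x = y" using inj by (simp add: map_inverse_eq_Some_iff)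
  qed
  then show ?thesis using assms inj
    by (simp add: local_bijection_def dom_map_inverse ran_map_inverse)
qed

lemma local_bijection_iff:
  "local_bijection X f \<longleftrightarrow> (\<forall>x y. f x = Some y \<longrightarrow> x \<in> X \<and> y \<in> X) \<and>
     (\<forall>x x' y. f x = Some y \<longrightarrow> f x' = Some y \<longrightarrow> x = x')"
  unfolding local_bijection_def inj_on_def dom_def ran_def by force

lemma permutation_groupoid_rigid:
  assumes "finite Y"
  shows "permutation_groupoid Y (rigid_groupoid Y)"
  unfolding permutation_groupoid_def
proof (intro conjI ballI allI impI)
  show "Some |` Y \<in> rigid_groupoid Y"
    by (auto simp: rigid_groupoid_def local_bijection_iff restrict_map_def split: if_splits)
  fix f assume "f \<in> rigid_groupoid Y"
  then have f: "local_bijection Y f" and id: "dom f = Y \<Longrightarrow> f = Some |` Y"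
    by (auto simp: rigid_groupoid_def)
  then have dom: "dom f \<subseteq> Y" and ran: "ran f \<subseteq> Y" and inj: "inj_on f (dom f)"
    by (auto simp: local_bijection_def)
  show "local_bijection Y f" by (rule f)
  show "f |` A \<in> rigid_groupoid Y" if "A \<subseteq> dom f" for A
  proof -
    have "local_bijection Y (f |` A)"
      using f by (auto simp: local_bijection_iff restrict_map_def split: if_splits)
    moreover have "f |` A = Some |` Y" if "dom (f |` A) = Y"
    proof -
      have "A = Y" "dom f = Y" using dom \<open>A \<subseteq> dom f\<close> that by auto
      then show ?thesis using id by simp
    qed
    ultimately show ?thesis by (simp add: rigid_groupoid_def)
  qed
  show "map_inverse f \<in> rigid_groupoid Y"
  proof -
    \<comment> \<open>The inverse is total when \<open>f\<close> is onto \<open>Y\<close>; by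
      finiteness \<open>f\<close> is then total too, hence the identity.\<close>
    have "map_inverse f = Some |` Y" if "ran f = Y"
    proof -
      have "card (dom f) = card Y"
      proof -
        have "Some ` ran f = f ` dom f" by (force simp: ran_def dom_def)
        then show ?thesis using inj that by (metis card_image inj_Some)
      qed
      then have eq: "f = Some |` Y" using id dom assms card_subset_eq by blast
      have "map_inverse f y = Some x \<longleftrightarrow> (Some |` Y) y = Some x" for x y
        using inj by (subst map_inverse_eq_Some_iff) (auto simp: eq restrict_map_def)
      then show ?thesis by (metis ext option.exhaust)
    qed
    then show ?thesis
      using f inj by (simp add: rigid_groupoid_def local_bijection_map_inverse dom_map_inverse)
  qed
  fix g assume g: "g \<in> rigid_groupoid Y" and rg: "ran g = dom f"
  show "f \<circ>\<^sub>m g \<in> rigid_groupoid Y"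
  proof -
    have "local_bijection Y (f \<circ>\<^sub>m g)"
      using f g unfolding rigid_groupoid_def local_bijection_iff
      by (auto simp: map_comp_def split: option.splits)
    \<comment> \<open>A total composite has a total inner map, which is the identity; its range
      \<open>Y\<close> is the domain of the outer map, which is then the identity as well.\<close>
    moreover have "f \<circ>\<^sub>m g = Some |` Y" if "dom (f \<circ>\<^sub>m g) = Y"
    proof -
      have "dom (f \<circ>\<^sub>m g) \<subseteq> dom g" by (auto simp: map_comp_def split: option.splits)
      then have "dom g = Y" using that g by (auto simp: rigid_groupoid_def local_bijection_def)
      then have gid: "g = Some |` Y" using g by (simp add: rigid_groupoid_def)
      have "ran (Some |` Y) = Y" by (auto simp: ran_def restrict_map_def split: if_splits)
      then have "dom f = Y" using rg gid by simp
      then have "f = Some |` Y" by (rule id)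
      then show ?thesis using gid by (auto simp: fun_eq_iff map_comp_def restrict_map_def)
    qed
    ultimately show ?thesis by (simp add: rigid_groupoid_def)
  qed
qed

lemma rigid_representatives:
  assumes "s permutes Y" "K \<subseteq> Y" "K \<noteq> Y"
  shows "s \<in> representatives Y (rigid_groupoid Y) K"
proof -
  have "local_bijection Y ((Some \<circ> s) |` K)"
    using assms permutes_in_image[OF assms(1)] permutes_inj[OF assms(1)]
    by (auto simp: local_bijection_iff restrict_map_def inj_eq split: if_splits)
  then show ?thesis using assms by (simp add: representatives_def rigid_groupoid_def del: dom_restrict)
qed

lemma rigid_representatives_top:
  assumes "s \<in> representatives Y (rigid_groupoid Y) Y" "i \<in> Y"
  shows "s i = i"
proof -
  have "(Some \<circ> s) |` Y = Some |` Y"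
    using assms(1) by (simp add: representatives_def rigid_groupoid_def del: dom_restrict)
  then have "((Some \<circ> s) |` Y) i = (Some |` Y) i" by simp
  then show ?thesis using assms(2) by simp
qed

text \<open>A monomial of degree less than 3 in two variables either misses a variable, and the
  groupoid then contains every permutation of \<open>Y\<close> restricted to its support, or it is
  the product of both variables, which each permutation of \<open>Y\<close> fixes.\<close>

lemma rigid_invariant_symmetric:
  fixes p :: "(nat, 'k::field) mpoly"
  defines "Y \<equiv> {0, 1}"
  assumes p: "p \<in> invariant_ring Y (rigid_groupoid Y)" and deg: "degree_less 3 p"
  shows "p \<in> symmetric_polys Y"
proof -
  interpret finite_permutation_groupoid Y "rigid_groupoid Y"
    by unfold_locales (simp_all add: Y_def permutation_groupoid_rigid)
  have inv: "invariant p" using p by (simp add: invariant_ring_eq)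
  then have pY: "p \<in> polys_in Y" by (simp add: invariant_def)
  have "lookup p (rename_monom s d) = lookup p d" if s: "s permutes Y" for s d
  proof -
    have b: "bij s" using s by (rule permutes_bij)
    consider "\<not> keys d \<subseteq> Y" | "keys d \<subseteq> Y" "keys d \<noteq> Y" | "keys d = Y" "monom_degree d < 3"
      | "monom_degree d \<ge> 3" by fastforce
    then show ?thesis
    proof cases
      case 1
      then have "\<not> keys (rename_monom s d) \<subseteq> Y"
        using permutes_in_image[OF s] by (auto simp: keys_rename_monom[OF b])
      then have "d \<notin> keys p" "rename_monom s d \<notin> keys p" using 1 pY by (auto simp: polys_in_def)
      then show ?thesis by (simp add: in_keys_iff)
    next
      case 2
      then show ?thesis using inv rigid_representatives[OF s] by (simp add: invariant_def)
    next
      case 3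
      \<comment> \<open>Two positive exponents with sum less than 3 are both 1.\<close>
      have "0 \<in> keys d" "1 \<in> keys d" using 3(1) by (auto simp: Y_def)
      then have "lookup d 0 \<noteq> 0" "lookup d 1 \<noteq> 0" by (simp_all add: in_keys_iff)
      moreover have "lookup d 0 + lookup d 1 < 3"
        using 3 by (simp add: monom_degree_def Y_def)
      ultimately have one: "lookup d i = 1" if "i \<in> Y" for i
        using that by (auto simp: Y_def)
      have "rename_monom s d = d"
      proof (rule rename_monom_eqI[OF b])
        fix i show "lookup d (s i) = lookup d i"
          using permutes_in_image[OF s, of i] permutes_not_in[OF s, of i] one by (cases "i \<in> Y") auto
      qed
      then show ?thesis by simp
    next
      case 4
      then have "d \<notin> keys p" "rename_monom s d \<notin> keys p"
        using deg by (auto simp: degree_less_def monom_degree_rename_monom[OF b] not_less)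
      then show ?thesis by (simp add: in_keys_iff)
    qed
  qed
  then show ?thesis using pY by (simp add: symmetric_polys_iff)
qed

text \<open>The invariants of degree less than 3 generate only symmetric polynomials, so a single
  non-symmetric invariant refutes generation.\<close>

lemma rigid_not_generated:
  defines "Y \<equiv> {0, 1 :: nat}"
  shows "module_generated (symmetric_polys Y) {p \<in> invariant_ring Y (rigid_groupoid Y). degree_less 3 p}
    \<noteq> (invariant_ring Y (rigid_groupoid Y) :: (nat, 'k::field) mpoly set)"
    (is "?M \<noteq> ?I")
proof -
  interpret finite_permutation_groupoid Y "rigid_groupoid Y"
    by unfold_locales (simp_all add: Y_def permutation_groupoid_rigid)
  \<comment> \<open>Both variables occur, so the orbit is a singleton; the exponents differ, so the
    transposition moves the monomial. Degree 3 is the least for which both hold.\<close>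
  define d :: "nat \<Rightarrow>\<^sub>0 nat" where "d = single 0 2 + single 1 1"
  have lookup_d: "lookup d i = (if i = 0 then 2 else if i = 1 then 1 else 0)" for i
    by (auto simp: d_def lookup_add lookup_single when_def simp del: single_numeral)
  have keys_d: "keys d = Y" by (auto simp: in_keys_iff lookup_d Y_def split: if_splits)
  let ?o = "orbit_sum (rigid_groupoid Y) d :: (nat, 'k) mpoly"
  let ?s = "transpose 0 (1 :: nat)"
  have "monom_orbit (rigid_groupoid Y) d \<subseteq> {d}"
    using rigid_representatives_top keys_d by (auto simp: monom_orbit_eq intro!: rename_monom_id)
  \<comment> \<open>At \<open>?s 1\<close>, which is \<open>0\<close>, the renamed vector has
    exponent 1 but \<open>d\<close> has exponent 2.\<close>
  moreover have "lookup (rename_monom ?s d) (?s 1) \<noteq> lookup d (?s 1)"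
    by (subst lookup_rename_monom) (auto simp: lookup_d)
  ultimately have "rename_monom ?s d \<notin> monom_orbit (rigid_groupoid Y) d" by auto
  moreover have "d \<in> monom_orbit (rigid_groupoid Y) d" by (simp add: monom_orbit_refl keys_d)
  ultimately have "lookup ?o (rename_monom ?s d) \<noteq> lookup ?o d" by (simp add: lookup_orbit_sum)
  moreover have "?s permutes Y" by (rule permutes_swap_id) (auto simp: Y_def)
  ultimately have "?o \<notin> symmetric_polys Y" by (auto simp: symmetric_polys_iff)
  moreover have "?M \<subseteq> symmetric_polys Y"
    unfolding module_generated_def
    by (intro hull_minimal is_submodule_symmetric_polys)
       (use rigid_invariant_symmetric Y_def in blast)
  moreover have "?o \<in> ?I" by (simp add: invariant_ring_eq invariant_orbit_sum keys_d)
  ultimately show ?thesis by blast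
qed

theorem theorem8:
  fixes X :: "'x set" and G :: "('x \<rightharpoonup> 'x) set"
  assumes "finite X" and "permutation_groupoid X G"
  shows "(\<exists>S. finite S \<and> S \<subseteq> invariant_ring X G \<and>
            (\<forall>p\<in>S. \<exists>n \<le> card X * (card X + 1) div 2. homogeneous n p) \<and>
            algebra_generated S = (invariant_ring X G :: ('x, 'k::field) mpoly set))
       \<and> (\<exists>S. finite S \<and> S \<subseteq> invariant_ring X G \<and>
            (\<forall>p\<in>S. \<exists>n \<le> card X * (card X + 1) div 2. homogeneous n p) \<and>
            module_generated (symmetric_polys X) S
              = (invariant_ring X G :: ('x, 'k) mpoly set))
       \<and> (\<exists>(Y :: nat set) H. finite Y \<and> Y \<noteq> {} \<and> permutation_groupoid Y H \<and>
            module_generated (symmetric_polys Y)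
              {p \<in> invariant_ring Y H. degree_less (card Y * (card Y + 1) div 2) p}
              \<noteq> (invariant_ring Y H :: (nat, 'k) mpoly set))"
proof (intro conjI)
  interpret finite_permutation_groupoid X G using assms by unfold_locales
  let ?n = "card X * (card X + 1) div 2"
  \<comment> \<open>The elementary symmetric polynomials among the algebra generators have degree at
    most \<open>card X\<close>, which stays within the bound.\<close>
  have "card X \<le> ?n" by (cases "card X") auto
  then have "\<exists>n \<le> ?n. homogeneous n (esym X k :: ('x, 'k) mpoly)" if "k \<le> card X" for k
    using that esym_homogeneous[OF finite_X] order_trans by blast
  then show "\<exists>S. finite S \<and> S \<subseteq> invariant_ring X G \<and> (\<forall>p\<in>S. \<exists>n \<le> ?n. homogeneous n p) \<and>
      algebra_generated S = (invariant_ring X G :: ('x, 'k) mpoly set)"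
    using generators algebra_generated_invariant_ring
    by (intro exI[of _ "generators \<union> esym X ` {1..card X}"])
       (auto simp: invariant_ring_eq invariant_esym)
  show "\<exists>S. finite S \<and> S \<subseteq> invariant_ring X G \<and> (\<forall>p\<in>S. \<exists>n \<le> ?n. homogeneous n p) \<and>
      module_generated (symmetric_polys X) S = (invariant_ring X G :: ('x, 'k) mpoly set)"
    using generators module_generated_invariant_ring by (intro exI[of _ generators]) blast
  show "\<exists>(Y :: nat set) H. finite Y \<and> Y \<noteq> {} \<and> permutation_groupoid Y H \<and>
      module_generated (symmetric_polys Y)
        {p \<in> invariant_ring Y H. degree_less (card Y * (card Y + 1) div 2) p}
        \<noteq> (invariant_ring Y H :: (nat, 'k) mpoly set)"
  proof (intro exI conjI)
    have "card {0, 1 :: nat} * (card {0, 1 :: nat} + 1) div 2 = 3" by simp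
    then show "module_generated (symmetric_polys {0, 1})
        {p \<in> invariant_ring {0, 1} (rigid_groupoid {0, 1}).
          degree_less (card {0, 1 :: nat} * (card {0, 1 :: nat} + 1) div 2) p}
        \<noteq> (invariant_ring {0, 1} (rigid_groupoid {0, 1}) :: (nat, 'k) mpoly set)"
      using rigid_not_generated[where 'k = 'k] by (simp only: not_False_eq_True)
  qed (simp_all add: permutation_groupoid_rigid)
qed

end
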